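(* Let $l\ge1$, $n\ge1$, $l\le k\le n$ and $m\ge l+n$. Let $\mathcal{D}\subseteq\mathbb{F}_{q^m}^{l+n}$ be a maximum rank distance (MRD) code of dimension $k$ with systematic generator matrix $G=\begin{bmatrix} I & P\end{bmatrix}\in\mathbb{F}_{q^m}^{k\times(l+n)}$, and let $\mathcal{C}_1,\mathcal{C}_2,\psi$ be the nested coset coding scheme built from $\mathcal{D}$ and $G$ as described in the context. Then this scheme has universal maximum strength $\Omega=k-1$.
   Context: $\mathbb{F}_{q^m}$ is the degree-$m$ extension of the finite field $\mathbb{F}_q$; linear codes are $\mathbb{F}_{q^m}$-subspaces, dimensions are over $\mathbb{F}_{q^m}$. For $x,y\in\mathbb{F}_{q^m}^N$ the rank distance $d_R(x,y)$ is the $\mathbb{F}_q$-dimension of the $\mathbb{F}_q$-span in $\mathbb{F}_{q^m}$ of the coordinates of $y-x$; $d_R(\mathcal{C})$ is the minimum of $d_R(x,0)$ over nonzero $x\in\mathcal{C}$. A linear code $\mathcal{C}\subseteq\mathbb{F}_{q^m}^N$ is MRD if $d_R(\mathcal{C})=\min\{1,m/N\}(N-\dim\mathcal{C})+1$ (so $=N-\dim\mathcal{C}+1$ when $m\ge N$). Construction: write $$G=\begin{bmatrix} I & \Delta G\\ O & G_2\end{bmatrix},$$ with $I$ the $l\times l$ identity, $\Delta G\in\mathbb{F}_{q^m}^{l\times n}$, $G_2\in\mathbb{F}_{q^m}^{(k-l)\times n}$. Let $\mathcal{C}_1\subseteq\mathbb{F}_{q^m}^n$ be the punctured code consisting of the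 last $n$ coordinates of all codewords of $\mathcal{D}$ (generated by the rows of $\Delta G$ and $G_2$), and $\mathcal{C}_2\subseteq\mathcal{C}_1$ the shortened code consisting of the last $n$ coordinates of those codewords of $\mathcal{D}$ whose first $l$ coordinates are zero (generated by the rows of $G_2$). Then $\dim\mathcal{C}_1=k$, $\dim\mathcal{C}_2=k-l$, and $\psi:\mathbb{F}_{q^m}^l\to\mathcal{C}_1/\mathcal{C}_2$, $\psi(S)=S\Delta G+\mathcal{C}_2$, is a linear bijection. Universal maximum strength: let $S=(S_1,\dots,S_l)$ be uniform on $\mathbb{F}_{q^m}^l$ and $X$ uniform on $\psi(S)$ given $S$; write $S_{\mathcal{Z}}=(S_i:i\in\mathcal{Z})$. Then $\Omega$ is the largest integer $\omega$ such that the mutual information $I(S_{\mathcal{Z}};BX^{\rm T})$ is $0$ for all $\mathcal{Z}\subseteq\{1,\dots,l\}$ and all $B\in\mathbb{F}_q^{(\omega-|\mathcal{Z}|+1)\times n}$ (vacuous for those $\mathcal{Z}$ with $\omega-|\mathcal{Z}|+1\le0$). *)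

theory Defs
  imports
    "HOL-Probability.Probability"
    "Jordan_Normal_Form.VS_Connect"
begin

hide_const (open) Finite_Cartesian_Product.vec
unbundle no vec_syntax

text \<open>
  The extension of \<open>F\<^sub>q\<close> of degree \<open>m\<close> is a finite field \<open>'a\<close> together with a field homomorphism
  \<open>\<iota>\<close> from the finite field \<open>'q\<close>; it is an \<open>'q\<close>-vector space under the scaling below. Vectors of
  length \<open>N\<close> are the elements of \<^term>\<open>carrier_vec N\<close>. They are the row vectors of coding
  theory, so that \<open>s A\<close> is rendered as \<^term>\<open>A\<^sup>T *\<^sub>v s\<close>. Coordinates are numbered from \<open>0\<close>.
\<close>

definition ext_scale :: "('q::field \<Rightarrow> 'a::field) \<Rightarrow> 'q \<Rightarrow> 'a \<Rightarrow> 'a" where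
  "ext_scale \<iota> c z = \<iota> c * z"

definition ext_degree :: "('q::field \<Rightarrow> 'a::field) \<Rightarrow> nat" where
  "ext_degree \<iota> = vector_space.dim (ext_scale \<iota>) UNIV"

definition rank_dist :: "('q::field \<Rightarrow> 'a::field) \<Rightarrow> 'a vec \<Rightarrow> 'a vec \<Rightarrow> nat" where
  "rank_dist \<iota> x y =
     vector_space.dim (ext_scale \<iota>) (Modules.module.span (ext_scale \<iota>) (set\<^sub>v (y - x)))"

definition linear_code :: "nat \<Rightarrow> 'a::field vec set \<Rightarrow> bool" where
  "linear_code N C \<longleftrightarrow> VectorSpace.subspace class_ring C (module_vec TYPE('a) N)"

definition code_dim :: "nat \<Rightarrow> 'a::field vec set \<Rightarrow> nat" where
  "code_dim N C = vectorspace.dim class_ring (module_vec TYPE('a) N \<lparr>carrier := C\<rparr>)"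

definition min_rank_dist :: "('q::field \<Rightarrow> 'a::field) \<Rightarrow> nat \<Rightarrow> 'a vec set \<Rightarrow> nat" where
  "min_rank_dist \<iota> N C = Min ((\<lambda>x. rank_dist \<iota> x (0\<^sub>v N)) ` (C - {0\<^sub>v N}))"

definition MRD_code :: "('q::field \<Rightarrow> 'a::field) \<Rightarrow> nat \<Rightarrow> 'a vec set \<Rightarrow> bool" where
  "MRD_code \<iota> N C \<longleftrightarrow> linear_code N C \<and>
     real (min_rank_dist \<iota> N C) =
       min 1 (real (ext_degree \<iota>) / real N) * (real N - real (code_dim N C)) + 1"

definition generator_matrix :: "nat \<Rightarrow> 'a::field vec set \<Rightarrow> 'a mat \<Rightarrow> bool" where
  "generator_matrix N C G \<longleftrightarrow>
     G \<in> carrier_mat (code_dim N C) N \<and> vec_space.row_space N G = C"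

definition append_cols :: "'a::zero mat \<Rightarrow> 'a mat \<Rightarrow> 'a mat" where
  "append_cols A B = four_block_mat A B (0\<^sub>m 0 (dim_col A)) (0\<^sub>m 0 (dim_col B))"

definition punctured_code :: "nat \<Rightarrow> 'a vec set \<Rightarrow> 'a vec set" where
  "punctured_code n D = (\<lambda>x. vec_last x n) ` D"

definition shortened_code :: "nat \<Rightarrow> nat \<Rightarrow> 'a::zero vec set \<Rightarrow> 'a vec set" where
  "shortened_code l n D = (\<lambda>x. vec_last x n) ` {x \<in> D. vec_first x l = 0\<^sub>v l}"

definition coset_encoder :: "'a::semiring_0 mat \<Rightarrow> 'a vec set \<Rightarrow> 'a vec \<Rightarrow> 'a vec set" where
  "coset_encoder \<Delta>G C\<^sub>2 s = (\<lambda>c. \<Delta>G\<^sup>T *\<^sub>v s + c) ` C\<^sub>2"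

text \<open>The joint law of \<open>(S, X)\<close>: \<open>S\<close> is uniform on the messages and \<open>X\<close> is uniform on \<open>\<psi> S\<close>.\<close>

definition scheme_pmf :: "nat \<Rightarrow> ('a vec \<Rightarrow> 'a vec set) \<Rightarrow> ('a vec \<times> 'a vec) pmf" where
  "scheme_pmf l \<psi> =
     do {s \<leftarrow> pmf_of_set (carrier_vec l); x \<leftarrow> pmf_of_set (\<psi> s); return_pmf (s, x)}"

text \<open>
  \<open>I(S\<^sub>Z; B X\<^sup>T)\<close> for a matrix \<open>B\<close> over the small field. The subvector \<open>S\<^sub>Z\<close> is the restriction of
  \<open>i \<mapsto> S\<^sub>i\<close> to \<open>Z\<close>, and the two alphabets are the finite sets \<open>Z \<rightarrow>\<^sub>E UNIV\<close> and the vectors of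
  length \<^term>\<open>dim_row B\<close>. Logarithms are to base 2.
\<close>

definition leakage ::
  "('q \<Rightarrow> 'a::semiring_0) \<Rightarrow> nat \<Rightarrow> ('a vec \<Rightarrow> 'a vec set) \<Rightarrow> nat set \<Rightarrow> 'q mat \<Rightarrow> real" where
  "leakage \<iota> l \<psi> Z B =
     prob_space.mutual_information (measure_pmf (scheme_pmf l \<psi>)) 2
       (count_space (Z \<rightarrow>\<^sub>E UNIV)) (count_space (carrier_vec (dim_row B)))
       (\<lambda>(s, x). restrict (\<lambda>i. s $ i) Z)
       (\<lambda>(s, x). map_mat \<iota> B *\<^sub>v x)"

definition universally_secure ::
  "('q \<Rightarrow> 'a::semiring_0) \<Rightarrow> nat \<Rightarrow> nat \<Rightarrow> ('a vec \<Rightarrow> 'a vec set) \<Rightarrow> int \<Rightarrow> bool" where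
  "universally_secure \<iota> l n \<psi> \<omega> \<longleftrightarrow>
     (\<forall>Z \<subseteq> {..<l}. \<omega> - int (card Z) + 1 > 0 \<longrightarrow>
        (\<forall>B \<in> carrier_mat (nat (\<omega> - int (card Z) + 1)) n. leakage \<iota> l \<psi> Z B = 0))"

definition is_universal_max_strength ::
  "('q \<Rightarrow> 'a::semiring_0) \<Rightarrow> nat \<Rightarrow> nat \<Rightarrow> ('a vec \<Rightarrow> 'a vec set) \<Rightarrow> int \<Rightarrow> bool" where
  "is_universal_max_strength \<iota> l n \<psi> \<Omega> \<longleftrightarrow>
     universally_secure \<iota> l n \<psi> \<Omega> \<and> (\<forall>\<omega>. universally_secure \<iota> l n \<psi> \<omega> \<longrightarrow> \<omega> \<le> \<Omega>)"

end

theory Submission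
  imports Defs
begin

text \<open>
  The pair \<open>(S, X)\<close> is uniform on \<open>D\<close>, whose minimum rank distance is \<open>N - k + 1\<close> with
  \<open>N = l + n\<close>. A vector killed by \<open>k\<close> independent linear forms over the small field has rank
  weight at most \<open>N - k\<close>, so any \<open>k\<close> such forms are injective on \<open>D\<close>, and by counting they map
  \<open>D\<close> bijectively onto all \<open>k\<close>-tuples. For security, complete \<open>B\<close> to \<open>k - |Z|\<close> independent rows
  \<open>B'\<close> whose span contains the rows of \<open>B\<close>: then \<open>(S\<^sub>Z, B' X)\<close> is uniform on a product, so
  \<open>S\<^sub>Z\<close> is independent of \<open>B' X\<close> and hence of \<open>B X\<close>. For maximality, \<open>k\<close> coordinates of \<open>X\<close>
  already determine the codeword, and in particular the nonconstant \<open>S\<^sub>0\<close>.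
\<close>

section \<open>Vanishing mutual information and uniform laws\<close>

text \<open>Mutual information is the divergence of the joint law \<open>Q\<close> from the product
  \<open>P\<close> of the marginals, and it vanishes exactly when the two measures agree. Countable
  alphabets make every set measurable, so agreement of measures reduces to agreement at points, that
  is, to equality of pmfs.\<close>

lemma mutual_information_pmf_eq_0_iff:
  fixes p :: "'c pmf"
  assumes "countable A" "countable B" "finite (set_pmf p)" "b > 1"
    and X: "\<And>\<omega>. X \<omega> \<in> A" and Y: "\<And>\<omega>. Y \<omega> \<in> B"
  shows "prob_space.mutual_information (measure_pmf p) b (count_space A) (count_space B) X Y = 0
    \<longleftrightarrow> map_pmf (\<lambda>\<omega>. (X \<omega>, Y \<omega>)) p = pair_pmf (map_pmf X p) (map_pmf Y p)"
proof -
  interpret information_space "measure_pmf p" b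
    by unfold_locales (fact \<open>b > 1\<close>)
  let ?S = "count_space A" and ?T = "count_space B"
  define P where "P = distr p ?S X \<Otimes>\<^sub>M distr p ?T Y"
  define Q where "Q = distr p (?S \<Otimes>\<^sub>M ?T) (\<lambda>\<omega>. (X \<omega>, Y \<omega>))"
  have rv1 [measurable]: "X \<in> measure_pmf p \<rightarrow>\<^sub>M ?S" and rv2 [measurable]: "Y \<in> measure_pmf p \<rightarrow>\<^sub>M ?T"
    using X Y by auto
  have ST: "?S \<Otimes>\<^sub>M ?T = count_space (A \<times> B)"
    by (rule pair_measure_countable) fact+
  interpret dX: prob_space "distr p ?S X"
    by (rule measure_pmf.prob_space_distr) fact
  interpret dY: prob_space "distr p ?T Y"
    by (rule measure_pmf.prob_space_distr) fact
  interpret dXY: pair_prob_space "distr p ?S X" "distr p ?T Y" ..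
  interpret P: information_space P b
    unfolding P_def by unfold_locales (fact \<open>b > 1\<close>)
  have sets_P: "sets P = Pow (A \<times> B)"
  proof -
    have "sets P = sets (?S \<Otimes>\<^sub>M ?T)"
      unfolding P_def by (rule sets_pair_measure_cong) auto
    then show ?thesis by (simp only: ST sets_count_space)
  qed
  have sets_Q: "sets Q = Pow (A \<times> B)"
    by (simp only: Q_def ST sets_distr sets_count_space)
  have P_point: "emeasure P {(a, c)} =
      ennreal (pmf (pair_pmf (map_pmf X p) (map_pmf Y p)) (a, c))" if "a \<in> A" "c \<in> B" for a c
  proof -
    have "emeasure P ({a} \<times> {c}) = emeasure (distr p ?S X) {a} * emeasure (distr p ?T Y) {c}"
      unfolding P_def using that by (intro dY.emeasure_pair_measure_Times) auto
    also have "\<dots> = emeasure p (X -` {a}) * emeasure p (Y -` {c})"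
      using that by (simp add: emeasure_distr[OF rv1] emeasure_distr[OF rv2])
    finally show ?thesis
      by (simp add: pmf_pair pmf_map measure_pmf.emeasure_eq_measure ennreal_mult)
  qed
  have Q_point: "emeasure Q {(a, c)} = ennreal (pmf (map_pmf (\<lambda>\<omega>. (X \<omega>, Y \<omega>)) p) (a, c))"
    if "a \<in> A" "c \<in> B" for a c
  proof -
    have "(\<lambda>\<omega>. (X \<omega>, Y \<omega>)) \<in> measure_pmf p \<rightarrow>\<^sub>M count_space (A \<times> B)"
      using X Y by simp
    then show ?thesis
      unfolding Q_def ST using that
      by (simp add: emeasure_distr pmf_map measure_pmf.emeasure_eq_measure)
  qed
  \<comment> \<open>A point of \<open>P\<close>-mass zero has a coordinate of marginal mass zero,
    hence joint mass zero; a null set is a countable union of such points.\<close>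
  have ac: "absolutely_continuous P Q"
    unfolding absolutely_continuous_def
  proof
    fix N assume N: "N \<in> null_sets P"
    then have sub: "N \<subseteq> A \<times> B"
      using sets_P by (auto simp: null_sets_def)
    have "emeasure Q {z} = 0" if "z \<in> N" for z
    proof -
      obtain a c where z: "z = (a, c)" "a \<in> A" "c \<in> B"
        using sub \<open>z \<in> N\<close> by auto
      have "emeasure P {z} \<le> emeasure P N"
        using N that by (intro emeasure_mono) auto
      then have "pmf (map_pmf X p) a * pmf (map_pmf Y p) c = 0"
        using N z P_point[OF z(2,3)] by (auto simp: null_sets_def pmf_pair)
      then have "a \<notin> set_pmf (map_pmf X p) \<or> c \<notin> set_pmf (map_pmf Y p)"
        by (simp only: pmf_eq_0_set_pmf mult_eq_0_iff)
      then have "(a, c) \<notin> set_pmf (map_pmf (\<lambda>\<omega>. (X \<omega>, Y \<omega>)) p)"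
        by auto
      then show ?thesis
        using z Q_point by (simp add: pmf_eq_0_set_pmf)
    qed
    moreover have "countable N"
      using sub by (rule countable_subset) (use assms(1,2) in auto)
    moreover have "\<And>z. z \<in> N \<Longrightarrow> {z} \<in> sets Q"
      using sub sets_Q by auto
    ultimately have "(\<Union>z\<in>N. {z}) \<in> null_sets Q"
      by (intro null_sets_UN') (auto intro: null_setsI)
    then show "N \<in> null_sets Q" by simp
  qed
  \<comment> \<open>Finite support of \<open>p\<close> makes any function integrable, whatever the
    density looks like.\<close>
  have "integrable Q (entropy_density b P Q)"
  proof -
    have "(\<lambda>\<omega>. (X \<omega>, Y \<omega>)) \<in> measure_pmf p \<rightarrow>\<^sub>M count_space (A \<times> B)"
      using X Y by simp
    then show ?thesis
      unfolding Q_def ST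
      by (subst integrable_distr_eq) (auto intro: integrable_measure_pmf_finite assms(3))
  qed
  then have "KL_divergence b P Q = 0 \<longleftrightarrow> Q = P"
  proof (intro P.KL_eq_0_iff_eq_ac ac)
    show "prob_space Q"
      unfolding Q_def ST by (rule measure_pmf.prob_space_distr) (use X Y in simp)
  qed (simp only: sets_P sets_Q)
  then have "prob_space.mutual_information p b ?S ?T X Y = 0 \<longleftrightarrow> P = Q"
    unfolding prob_space.mutual_information_def[OF prob_space_measure_pmf] P_def[symmetric] Q_def[symmetric] by auto
  also have "\<dots> \<longleftrightarrow> map_pmf (\<lambda>\<omega>. (X \<omega>, Y \<omega>)) p = pair_pmf (map_pmf X p) (map_pmf Y p)"
    (is "_ \<longleftrightarrow> ?J = ?K")
  proof
    assume "P = Q"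
    show "?J = ?K"
    proof (rule pmf_eqI)
      fix z :: "'a \<times> 'b"
      obtain a c where z: "z = (a, c)" by fastforce
      show "pmf ?J z = pmf ?K z"
      proof (cases "a \<in> A \<and> c \<in> B")
        case True
        then show ?thesis
          using P_point[of a c] Q_point[of a c] \<open>P = Q\<close> z by simp
      next
        case False
        then have "z \<notin> set_pmf ?J" "z \<notin> set_pmf ?K"
          using z X Y by auto
        then show ?thesis unfolding pmf_eq_0_set_pmf[symmetric] by simp
      qed
    qed
  next
    assume "?J = ?K"
    show "P = Q"
    proof (rule measure_eqI_countable[where A = "A \<times> B"])
      fix z assume "z \<in> A \<times> B"
      then show "emeasure P {z} = emeasure Q {z}"
        using P_point Q_point \<open>?J = ?K\<close> by auto
    qed (use sets_P sets_Q assms(1,2) in auto)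
  qed
  finally show ?thesis .
qed

text \<open>Fibres of equal size give every pair the same probability
  \<open>1 / (card A * c)\<close>. This serves both for a message followed by a point of its coset
  and, with a constant fibre, for products.\<close>

lemma pmf_of_set_Sigma:
  assumes "finite A" "A \<noteq> {}" "\<And>s. s \<in> A \<Longrightarrow> finite (\<Psi> s)" "\<And>s. s \<in> A \<Longrightarrow> card (\<Psi> s) = c" "c > 0"
  shows "do {s \<leftarrow> pmf_of_set A; x \<leftarrow> pmf_of_set (\<Psi> s); return_pmf (s, x)} = pmf_of_set (Sigma A \<Psi>)"
proof -
  have ne: "\<Psi> s \<noteq> {}" if "s \<in> A" for s
    using assms(4)[OF that] assms(5) by auto
  have "pmf_of_set (Sigma A \<Psi>) = pmf_of_set (\<Union>s\<in>A. Pair s ` \<Psi> s)"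
    by (rule arg_cong[where f = pmf_of_set]) auto
  also have "\<dots> = pmf_of_set A \<bind> (\<lambda>s. pmf_of_set (Pair s ` \<Psi> s))"
  proof (rule pmf_of_set_UN[where n = c])
    show "finite (\<Union>s\<in>A. Pair s ` \<Psi> s)"
      using assms(1,3) by auto
    show "card (Pair s ` \<Psi> s) = c" if "s \<in> A" for s
      using assms(4)[OF that] by (simp add: card_image inj_on_def)
  qed (use assms ne in \<open>auto simp: disjoint_family_on_def\<close>)
  also have "\<dots> = do {s \<leftarrow> pmf_of_set A; x \<leftarrow> pmf_of_set (\<Psi> s); return_pmf (s, x)}"
  proof (rule bind_pmf_cong[OF refl])
    fix s assume "s \<in> set_pmf (pmf_of_set A)"
    then have "s \<in> A" using assms(1,2) by simp
    then show "pmf_of_set (Pair s ` \<Psi> s) = pmf_of_set (\<Psi> s) \<bind> (\<lambda>x. return_pmf (s, x))"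
      using map_pmf_of_set_inj[of "Pair s" "\<Psi> s"] assms(3) ne
      by (simp add: inj_on_def map_pmf_def)
  qed
  finally show ?thesis ..
qed

section \<open>Rank weight and independent linear forms over a finite field\<close>

text \<open>Distinct coefficient functions on an independent subset of size \<open>dim S\<close>
  give distinct elements of the span. A bound on the cardinality of a span thereby bounds its
  dimension.\<close>

lemma card_span_ge:
  fixes scale :: "'q::{finite, field} \<Rightarrow> 'b::{finite, ab_group_add} \<Rightarrow> 'b"
  assumes "vector_space scale"
  shows "CARD('q) ^ vector_space.dim scale S \<le> card (Modules.module.span scale S)"
proof -
  interpret vector_space scale by fact
  obtain B where B: "B \<subseteq> S" "independent B" "card B = dim S"
    by (rule basis_exists)
  have "inj_on (\<lambda>f. \<Sum>b\<in>B. scale (f b) b) (B \<rightarrow>\<^sub>E UNIV)"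
  proof (rule inj_onI)
    fix f g assume fg: "f \<in> B \<rightarrow>\<^sub>E UNIV" "g \<in> B \<rightarrow>\<^sub>E UNIV"
      and eq: "(\<Sum>b\<in>B. scale (f b) b) = (\<Sum>b\<in>B. scale (g b) b)"
    have "(\<Sum>b\<in>B. scale (f b - g b) b) = 0"
      using eq by (simp add: scale_left_diff_distrib sum_subtractf)
    then have "f b - g b = 0" if "b \<in> B" for b
      using independentD[OF B(2) _ subset_refl, of "\<lambda>b. f b - g b"] that by simp
    then show "f = g"
      using fg by (intro PiE_ext) auto
  qed
  moreover have "(\<lambda>f. \<Sum>b\<in>B. scale (f b) b) ` (B \<rightarrow>\<^sub>E UNIV) \<subseteq> span S"
    using B(1) by (auto intro!: span_sum span_scale intro: span_base)
  ultimately have "card (B \<rightarrow>\<^sub>E (UNIV :: 'q set)) \<le> card (span S)"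
    by (intro card_inj_on_le) auto
  then show ?thesis
    using B(3) by (simp add: card_PiE)
qed

lemma vector_space_ext_scale:
  assumes "field_hom \<iota>"
  shows "vector_space (ext_scale \<iota>)"
proof -
  interpret field_hom \<iota> by fact
  show ?thesis
    by unfold_locales (auto simp: ext_scale_def algebra_simps hom_distribs)
qed

lemma CARD_field_gt_1: "CARD('f::{finite, field}) > 1"
proof -
  have "card {0, 1 :: 'f} \<le> CARD('f)"
    by (rule card_mono) auto
  then show ?thesis by simp
qed

text \<open>The rows form an indexed family cut off at column \<open>N\<close>: equal rows under
  different indices count as dependent, and any index set is allowed, such as
  \<open>Z \<union> {l..<l + r}\<close> later.\<close>

definition independent_rows :: "'i set \<Rightarrow> nat \<Rightarrow> ('i \<Rightarrow> nat \<Rightarrow> 'q::field) \<Rightarrow> bool" where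
  "independent_rows I N h \<longleftrightarrow>
     (\<forall>c. (\<forall>j<N. (\<Sum>i\<in>I. c i * h i j) = 0) \<longrightarrow> (\<forall>i\<in>I. c i = 0))"

text \<open>
  The coordinates of \<open>x\<close> span the image of the form \<open>v \<mapsto> \<Sum>\<^sub>j \<iota>(v\<^sub>j) x\<^sub>j\<close>. Translating by
  combinations of the rows \<open>h\<close> preserves its fibres, so each has at least \<open>q\<^bsup>|I|\<^esup>\<close> elements; this
  count replaces the rank-nullity theorem.
\<close>

lemma rank_dist_le:
  fixes \<iota> :: "'q::{finite, field} \<Rightarrow> 'a::{finite, field}" and h :: "'i \<Rightarrow> nat \<Rightarrow> 'q"
  assumes "field_hom \<iota>" and "finite I" and indep: "independent_rows I N h"
    and x: "x \<in> carrier_vec N"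
    and ker: "\<And>i. i \<in> I \<Longrightarrow> (\<Sum>j<N. \<iota> (h i j) * x $ j) = 0"
  shows "rank_dist \<iota> x (0\<^sub>v N) + card I \<le> N"
proof -
  interpret field_hom \<iota> by fact
  interpret vs: vector_space "ext_scale \<iota>"
    by (rule vector_space_ext_scale) fact
  define \<phi> where "\<phi> v = (\<Sum>j<N. \<iota> (v j) * x $ j)" for v
  define V :: "(nat \<Rightarrow> 'q) set" where "V = {..<N} \<rightarrow>\<^sub>E UNIV"
  define tr where "tr v c = restrict (\<lambda>j. v j + (\<Sum>i\<in>I. c i * h i j)) {..<N}" for v and c :: "'i \<Rightarrow> 'q"
  have \<phi>_restrict: "\<phi> (restrict v {..<N}) = \<phi> v" for v
    by (simp add: \<phi>_def)
  have in_image: "\<phi> v \<in> \<phi> ` V" for v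
    by (rule image_eqI[of _ _ "restrict v {..<N}"]) (auto simp: \<phi>_restrict V_def)
  have \<phi>_tr: "\<phi> (tr v c) = \<phi> v" for v c
  proof -
    have "\<phi> (tr v c) = \<phi> v + (\<Sum>j<N. \<Sum>i\<in>I. \<iota> (c i) * (\<iota> (h i j) * x $ j))"
      by (simp add: tr_def \<phi>_restrict) 
        (simp add: \<phi>_def hom_distribs sum.distrib distrib_right sum_distrib_right mult.assoc)
    also have "(\<Sum>j<N. \<Sum>i\<in>I. \<iota> (c i) * (\<iota> (h i j) * x $ j))
        = (\<Sum>i\<in>I. \<iota> (c i) * (\<Sum>j<N. \<iota> (h i j) * x $ j))"
      by (subst sum.swap) (simp add: sum_distrib_left)
    finally show ?thesis by (simp add: ker)
  qed
  \<comment> \<open>A section of \<open>\<phi>\<close>. Translating the chosen preimage of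
    \<open>y\<close> by the combination with coefficients \<open>c\<close> embeds the pairs
    \<open>(y, c)\<close> into \<open>V\<close>: applying \<open>\<phi>\<close> recovers
    \<open>y\<close>, and independence of the rows then recovers \<open>c\<close>.\<close>
  define \<sigma> where "\<sigma> = inv_into V \<phi>"
  have \<sigma>: "\<phi> (\<sigma> y) = y" if "y \<in> \<phi> ` V" for y
    using that by (simp add: \<sigma>_def f_inv_into_f)
  have "inj_on (\<lambda>(y, c). tr (\<sigma> y) c) (\<phi> ` V \<times> (I \<rightarrow>\<^sub>E UNIV))"
  proof (rule inj_onI, clarify)
    fix v v' c c'
    assume c: "c \<in> I \<rightarrow>\<^sub>E UNIV" "c' \<in> I \<rightarrow>\<^sub>E UNIV"
      and vV: "v \<in> V" "v' \<in> V" and eq: "tr (\<sigma> (\<phi> v)) c = tr (\<sigma> (\<phi> v')) c'"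
    have v: "\<phi> v = \<phi> v'"
      using arg_cong[OF eq, of \<phi>] vV by (simp add: \<phi>_tr \<sigma>)
    have "\<forall>j<N. (\<Sum>i\<in>I. (c i - c' i) * h i j) = 0"
    proof (intro allI impI)
      fix j assume "j < N"
      then show "(\<Sum>i\<in>I. (c i - c' i) * h i j) = 0"
        using fun_cong[OF eq, of j] v by (simp add: tr_def left_diff_distrib sum_subtractf)
    qed
    then have "\<forall>i\<in>I. c i - c' i = 0"
      using indep[unfolded independent_rows_def, rule_format, of "\<lambda>i. c i - c' i"] by blast
    then have "c = c'"
      using c by (intro PiE_ext) auto
    with v show "\<phi> v = \<phi> v' \<and> c = c'" ..
  qed
  moreover have "(\<lambda>(y, c). tr (\<sigma> y) c) ` (\<phi> ` V \<times> (I \<rightarrow>\<^sub>E UNIV)) \<subseteq> V"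
    by (auto simp: tr_def V_def)
  moreover have "finite V"
    by (auto simp: V_def intro: finite_PiE)
  ultimately have "card (\<phi> ` V \<times> (I \<rightarrow>\<^sub>E (UNIV :: 'q set))) \<le> card V"
    by (intro card_inj_on_le)
  then have card: "card (\<phi> ` V) * CARD('q) ^ card I \<le> CARD('q) ^ N"
    using \<open>finite I\<close> by (simp add: card_cartesian_product card_PiE V_def)
  have "set\<^sub>v (0\<^sub>v N - x) \<subseteq> \<phi> ` V"
  proof
    fix a assume "a \<in> set\<^sub>v (0\<^sub>v N - x)"
    then obtain j where j: "j < N" "a = - x $ j"
      using x by (auto simp: vec_set_def)
    \<comment> \<open>The sign is there because \<open>rank_dist\<close> takes the coordinates of
      the second argument minus the first, here \<open>- x $ j\<close>.\<close>
    have "\<phi> (\<lambda>i. if i = j then - 1 else 0) = (\<Sum>i<N. if i = j then - x $ i else 0)"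
      unfolding \<phi>_def by (intro sum.cong) (auto simp: hom_distribs)
    also have "\<dots> = a"
      using j by simp
    finally show "a \<in> \<phi> ` V"
      using in_image by metis
  qed
  moreover have "vs.subspace (\<phi> ` V)"
  proof (rule vs.subspaceI)
    show "0 \<in> \<phi> ` V"
      using in_image[of "\<lambda>_. 0"] by (simp add: \<phi>_def)
    show "a + b \<in> \<phi> ` V" if "a \<in> \<phi> ` V" "b \<in> \<phi> ` V" for a b
    proof -
      obtain v w where "a = \<phi> v" "b = \<phi> w" using \<open>a \<in> \<phi> ` V\<close> \<open>b \<in> \<phi> ` V\<close> by auto
      then have "a + b = \<phi> (\<lambda>j. v j + w j)"
        by (simp add: \<phi>_def hom_distribs distrib_right sum.distrib)
      then show ?thesis using in_image by simp
    qed
    show "ext_scale \<iota> c a \<in> \<phi> ` V" if "a \<in> \<phi> ` V" for c a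
    proof -
      obtain v where "a = \<phi> v" using \<open>a \<in> \<phi> ` V\<close> by auto
      then have "ext_scale \<iota> c a = \<phi> (\<lambda>j. c * v j)"
        by (simp add: \<phi>_def ext_scale_def hom_distribs sum_distrib_left mult.assoc)
      then show ?thesis using in_image by simp
    qed
  qed
  ultimately have "vs.span (set\<^sub>v (0\<^sub>v N - x)) \<subseteq> \<phi> ` V"
    by (rule vs.span_minimal)
  then have "card (vs.span (set\<^sub>v (0\<^sub>v N - x))) \<le> card (\<phi> ` V)"
    by (intro card_mono) auto
  with card_span_ge[OF vs.vector_space_axioms, of "set\<^sub>v (0\<^sub>v N - x)"]
  have "CARD('q) ^ rank_dist \<iota> x (0\<^sub>v N) \<le> card (\<phi> ` V)"
    by (simp add: rank_dist_def)
  then have "CARD('q) ^ (rank_dist \<iota> x (0\<^sub>v N) + card I) \<le> CARD('q) ^ N"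
    using card by (metis mult_le_mono1 order_trans power_add)
  then show ?thesis
    by (rule power_le_imp_le_exp[OF CARD_field_gt_1])
qed

text \<open>Replaces \<open>r\<close> possibly dependent rows \<open>v\<close> by independent rows
  \<open>w\<close> with \<open>v = T w\<close>. Rows are added one at a time; whenever the next row
  of \<open>v\<close> brings nothing new, any vector outside the current span fills the
  place.\<close>

lemma independent_rows_covering:
  fixes v :: "nat \<Rightarrow> nat \<Rightarrow> 'q::{finite, field}"
  assumes "r \<le> n"
  obtains w T where "independent_rows {..<r} n w"
    and "\<And>i j. i < r \<Longrightarrow> j < n \<Longrightarrow> v i j = (\<Sum>t<r. T i t * w t j)"
proof -
  have "\<exists>w T. independent_rows {..<r} n w \<and>
      (\<forall>i<r. \<forall>j<n. v i j = (\<Sum>t<r. T i t * w t j))"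
    using assms
  proof (induction r)
    case 0
    then show ?case by (simp add: independent_rows_def)
  next
    case (Suc r)
    then obtain w T where w: "independent_rows {..<r} n w"
      and T: "\<forall>i<r. \<forall>j<n. v i j = (\<Sum>t<r. T i t * w t j)" by auto
    define span_w where "span_w u \<longleftrightarrow> (\<exists>c. \<forall>j<n. u j = (\<Sum>t<r. c t * w t j))" for u
    \<comment> \<open>By counting: combinations of \<open>r\<close> rows give at most
      \<open>q^r\<close> vectors, fewer than the \<open>q^n\<close> available since
      \<open>r < n\<close>.\<close>
    have "\<exists>u. \<not> span_w u"
    proof (rule ccontr)
      assume "\<nexists>u. \<not> span_w u"
      then have all: "span_w u" for u by blast
      define f where "f c = restrict (\<lambda>j. \<Sum>t<r. c t * w t j) {..<n}" for c
      have "({..<n} \<rightarrow>\<^sub>E UNIV) \<subseteq> f ` ({..<r} \<rightarrow>\<^sub>E UNIV)"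
      proof
        fix u :: "nat \<Rightarrow> 'q" assume u: "u \<in> {..<n} \<rightarrow>\<^sub>E UNIV"
        obtain c where c: "\<forall>j<n. u j = (\<Sum>t<r. c t * w t j)"
          using all[of u] unfolding span_w_def by blast
        have "u = f (restrict c {..<r})"
          using u c by (intro ext) (auto simp: f_def PiE_def extensional_def)
        then show "u \<in> f ` ({..<r} \<rightarrow>\<^sub>E UNIV)" by auto
      qed
      then have "card ({..<n} \<rightarrow>\<^sub>E (UNIV :: 'q set)) \<le> card ({..<r} \<rightarrow>\<^sub>E (UNIV :: 'q set))"
        by (meson finite_PiE finite_lessThan finite surj_card_le)
      then have "CARD('q) ^ n \<le> CARD('q) ^ r"
        by (simp add: card_PiE)
      then have "n \<le> r"
        by (rule power_le_imp_le_exp[OF CARD_field_gt_1])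
      with Suc.prems show False by simp
    qed
    \<comment> \<open>The new row is \<open>v r\<close> itself if it lies outside the span, and an
      arbitrary outside vector otherwise.\<close>
    then obtain u where u: "\<not> span_w u" and vr: "span_w (v r) \<or> v r = u" by blast
    define w' where "w' = w(r := u)"
    have "independent_rows {..<Suc r} n w'"
      unfolding independent_rows_def
    proof (intro allI impI)
      fix c assume "\<forall>j<n. (\<Sum>i<Suc r. c i * w' i j) = 0"
      then have c: "\<forall>j<n. (\<Sum>i<r. c i * w i j) + c r * u j = 0"
        by (simp add: w'_def)
      have "c r = 0"
      proof (rule ccontr)
        assume "c r \<noteq> 0"
        have "\<forall>j<n. u j = (\<Sum>t<r. (- c t / c r) * w t j)"
        proof (intro allI impI)
          fix j assume "j < n"
          have "(\<Sum>t<r. (- c t / c r) * w t j) = - (\<Sum>t<r. c t * w t j) / c r"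
            by (simp add: sum_negf sum_divide_distrib)
          also have "- (\<Sum>t<r. c t * w t j) = c r * u j"
            using c \<open>j < n\<close> by (intro minus_unique) simp
          also have "c r * u j / c r = u j"
            using \<open>c r \<noteq> 0\<close> by simp
          finally show "u j = (\<Sum>t<r. (- c t / c r) * w t j)" ..
        qed
        then have "span_w u"
          unfolding span_w_def by (intro exI[of _ "\<lambda>t. - c t / c r"])
        with u show False ..
      qed
      moreover have "\<forall>i\<in>{..<r}. c i = 0"
      proof -
        have "\<forall>j<n. (\<Sum>i<r. c i * w i j) = 0"
          using c \<open>c r = 0\<close> by simp
        with w show ?thesis
          unfolding independent_rows_def by (rule_tac mp[OF spec[of _ c]])
      qed
      ultimately show "\<forall>i\<in>{..<Suc r}. c i = 0"
        by (auto simp: less_Suc_eq)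
    qed
    moreover have "\<exists>a. \<forall>j<n. v i j = (\<Sum>t<Suc r. a t * w' t j)" if "i < Suc r" for i
    proof (cases "span_w (v i)")
      case True
      then obtain c where "\<forall>j<n. v i j = (\<Sum>t<r. c t * w t j)"
        unfolding span_w_def by blast
      then show ?thesis
        \<comment> \<open>The value of \<open>c\<close> at \<open>r\<close> is arbitrary, so it is
          reset to keep the new row out of the combination.\<close>
        by (intro exI[of _ "c(r := 0)"]) (simp add: w'_def)
    next
      case False
      have "i = r"
        using that T False by (auto simp: span_w_def less_Suc_eq)
      with vr False have "v i = u" by simp
      then show ?thesis
        by (intro exI[of _ "\<lambda>t. if t = r then 1 else 0"]) (simp add: w'_def)
    qed
    then have "\<exists>T. \<forall>i<Suc r. \<forall>j<n. v i j = (\<Sum>t<Suc r. T i t * w' t j)"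
      by metis
    ultimately show ?case by blast
  qed
  then show thesis using that by blast
qed

section \<open>Finite vector spaces and separation of codewords in MRD codes\<close>

lemma sum_lessThan_add:
  fixes F :: "nat \<Rightarrow> 'b::comm_monoid_add"
  shows "(\<Sum>j<l + n. F j) = (\<Sum>j<l. F j) + (\<Sum>j<n. F (l + j))"
  by (induction n) (simp_all add: add.assoc)

lemma bij_betw_vec_PiE:
  "bij_betw (\<lambda>v. restrict (\<lambda>i. v $ i) {..<n}) (carrier_vec n) ({..<n} \<rightarrow>\<^sub>E UNIV)"
proof (rule bij_betwI[where g = "vec n"])
  fix f :: "nat \<Rightarrow> 'a" assume "f \<in> {..<n} \<rightarrow>\<^sub>E UNIV"
  then show "restrict (\<lambda>i. vec n f $ i) {..<n} = f"
    by (auto simp: PiE_def extensional_def restrict_def)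
qed auto

lemma finite_carrier_vec: "finite (carrier_vec n :: 'a::finite vec set)"
  using bij_betw_finite[OF bij_betw_vec_PiE[where 'a = 'a, of n]] by (simp add: finite_PiE)

lemma card_carrier_vec: "card (carrier_vec n :: 'a::finite vec set) = CARD('a) ^ n"
  using bij_betw_same_card[OF bij_betw_vec_PiE[where 'a = 'a, of n]] by (simp add: card_PiE)

text \<open>The difference of two codewords with equal values is killed by
  \<open>code_dim N D\<close> independent forms, so its rank weight is at most
  \<open>N - code_dim N D\<close>. This is one less than the minimum distance, so the difference is
  zero.\<close>

lemma MRD_code_separating:
  fixes \<iota> :: "'q::{finite, field} \<Rightarrow> 'a::{finite, field}"
  assumes "field_hom \<iota>" "MRD_code \<iota> N D" "N \<le> ext_degree \<iota>" "N > 0"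
    and D: "D \<subseteq> carrier_vec N" "\<And>x y. x \<in> D \<Longrightarrow> y \<in> D \<Longrightarrow> x - y \<in> D"
    and I: "finite I" "card I = code_dim N D" "independent_rows I N h"
    and xy: "x \<in> D" "y \<in> D"
    and eq: "\<And>i. i \<in> I \<Longrightarrow> (\<Sum>j<N. \<iota> (h i j) * x $ j) = (\<Sum>j<N. \<iota> (h i j) * y $ j)"
  shows "x = y"
proof (rule ccontr)
  assume "x \<noteq> y"
  have carr: "x \<in> carrier_vec N" "y \<in> carrier_vec N" using xy D by auto
  have "x - y \<noteq> 0\<^sub>v N"
  proof
    assume eq0: "x - y = 0\<^sub>v N"
    have "x = y"
    proof (rule eq_vecI)
      fix i assume "i < dim_vec y"
      then show "x $ i = y $ i"
        using arg_cong[OF eq0, of "\<lambda>v. v $ i"] carr by simp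
    qed (use carr in simp)
    with \<open>x \<noteq> y\<close> show False ..
  qed
  then have "x - y \<in> D - {0\<^sub>v N}" using D xy by auto
  moreover have "finite D"
    using D finite_carrier_vec finite_subset by blast
  ultimately have "min_rank_dist \<iota> N D \<le> rank_dist \<iota> (x - y) (0\<^sub>v N)"
    unfolding min_rank_dist_def by (intro Min_le) auto
  moreover have "rank_dist \<iota> (x - y) (0\<^sub>v N) + card I \<le> N"
  proof (rule rank_dist_le[OF \<open>field_hom \<iota>\<close> I(1,3)])
    show "x - y \<in> carrier_vec N" using carr by simp
    fix i assume "i \<in> I"
    have "(\<Sum>j<N. \<iota> (h i j) * (x - y) $ j)
        = (\<Sum>j<N. \<iota> (h i j) * x $ j) - (\<Sum>j<N. \<iota> (h i j) * y $ j)"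
      using carr by (simp add: right_diff_distrib sum_subtractf)
    then show "(\<Sum>j<N. \<iota> (h i j) * (x - y) $ j) = 0"
      using eq[OF \<open>i \<in> I\<close>] by simp
  qed
  ultimately have "real (min_rank_dist \<iota> N D) + real (code_dim N D) \<le> real N"
    using I(2) by linarith
  \<comment> \<open>With \<open>N \<le> ext_degree \<iota>\<close> the MRD bound takes its Singleton
    form \<open>N - code_dim N D + 1\<close>.\<close>
  moreover have "min 1 (real (ext_degree \<iota>) / real N) = 1"
    using assms(3,4) by (simp add: min_def)
  ultimately show False
    using \<open>MRD_code \<iota> N D\<close> by (simp add: MRD_code_def)
qed

lemma pair_pmf_of_set:
  assumes "finite A" "A \<noteq> {}" "finite B" "B \<noteq> {}"
  shows "pair_pmf (pmf_of_set A) (pmf_of_set B) = pmf_of_set (A \<times> B)"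
  using pmf_of_set_Sigma[of A "\<lambda>_. B" "card B"] assms
  by (simp add: pair_pmf_def card_gt_0_iff)

section \<open>Codewords split into message and transmitted vector\<close>

text \<open>Collects what the security argument uses of an MRD code: its size, the injectivity of
  any \<open>k\<close> independent forms over the small field, and the fact that every message
  begins some codeword.\<close>

locale separating_code =
  fixes \<iota> :: "'q::{finite, field} \<Rightarrow> 'a::{finite, field}"
    and l n k :: nat and D :: "'a vec set"
  assumes hom: "field_hom \<iota>"
    and l_pos: "l \<ge> 1" and l_le_k: "l \<le> k" and k_le_n: "k \<le> n"
    and D_carrier: "D \<subseteq> carrier_vec (l + n)"
    and card_D: "card D = CARD('a) ^ k"
    and separating: "\<And>(I :: nat set) h x y. finite I \<Longrightarrow> card I = k \<Longrightarrow>
      independent_rows I (l + n) h \<Longrightarrow> x \<in> D \<Longrightarrow> y \<in> D \<Longrightarrow>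
      (\<And>i. i \<in> I \<Longrightarrow> (\<Sum>j<l + n. \<iota> (h i j) * x $ j) = (\<Sum>j<l + n. \<iota> (h i j) * y $ j)) \<Longrightarrow> x = y"
    and systematic: "\<And>s. s \<in> carrier_vec l \<Longrightarrow> \<exists>x\<in>carrier_vec n. s @\<^sub>v x \<in> D"
begin

sublocale field_hom \<iota> by (rule hom)

text \<open>The support of \<open>(S, X)\<close>: codewords cut after their first \<open>l\<close>
  coordinates.\<close>

definition splittings :: "('a vec \<times> 'a vec) set" where
  "splittings = {(s, x). s \<in> carrier_vec l \<and> x \<in> carrier_vec n \<and> s @\<^sub>v x \<in> D}"

lemma bij_betw_splittings: "bij_betw (\<lambda>(s, x). s @\<^sub>v x) splittings D"
  unfolding bij_betw_def
proof
  show "inj_on (\<lambda>(s, x). s @\<^sub>v x) splittings"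
    by (auto simp: inj_on_def splittings_def)
  show "(\<lambda>(s, x). s @\<^sub>v x) ` splittings = D"
  proof
    show "D \<subseteq> (\<lambda>(s, x). s @\<^sub>v x) ` splittings"
    proof
      fix z assume "z \<in> D"
      then have "vec_first z l @\<^sub>v vec_last z n = z"
        using D_carrier by (intro vec_first_last_append) auto
      with \<open>z \<in> D\<close> show "z \<in> (\<lambda>(s, x). s @\<^sub>v x) ` splittings"
        by (intro image_eqI[of _ _ "(vec_first z l, vec_last z n)"]) (auto simp: splittings_def)
    qed
  qed (auto simp: splittings_def)
qed

lemma card_splittings: "card splittings = CARD('a) ^ k"
  using bij_betw_same_card[OF bij_betw_splittings] card_D by simp

lemma splittings_finite_nonempty: "finite splittings" "splittings \<noteq> {}"
  using card_splittings by (auto intro: card_ge_0_finite)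

lemma separating_splittings:
  fixes I :: "nat set"
  assumes "finite I" "card I = k" "independent_rows I (l + n) h"
    and "(s, x) \<in> splittings" "(s', x') \<in> splittings"
    and "\<And>i. i \<in> I \<Longrightarrow>
      (\<Sum>j<l. \<iota> (h i j) * s $ j) + (\<Sum>j<n. \<iota> (h i (l + j)) * x $ j) =
      (\<Sum>j<l. \<iota> (h i j) * s' $ j) + (\<Sum>j<n. \<iota> (h i (l + j)) * x' $ j)"
  shows "s = s' \<and> x = x'"
proof -
  have "s @\<^sub>v x = s' @\<^sub>v x'"
    using assms by (intro separating[OF assms(1-3)]) (auto simp: splittings_def sum_lessThan_add)
  then show ?thesis
    using assms(4,5) by (auto simp: splittings_def)
qed

lemma leakage_eq_0_iff:
  fixes B :: "'q mat"
  assumes "scheme_pmf l \<psi> = pmf_of_set splittings" "Z \<subseteq> {..<l}"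
  defines "X \<equiv> \<lambda>(s :: 'a vec, x :: 'a vec). restrict (\<lambda>i. s $ i) Z"
    and "Y \<equiv> \<lambda>(s :: 'a vec, x). map_mat \<iota> B *\<^sub>v x"
  shows "leakage \<iota> l \<psi> Z B = 0 \<longleftrightarrow>
    map_pmf (\<lambda>e. (X e, Y e)) (pmf_of_set splittings)
      = pair_pmf (map_pmf X (pmf_of_set splittings)) (map_pmf Y (pmf_of_set splittings))"
  unfolding leakage_def assms(1) X_def Y_def
proof (rule mutual_information_pmf_eq_0_iff)
  have "finite Z" using assms(2) finite_subset by blast
  then show "countable (Z \<rightarrow>\<^sub>E (UNIV :: 'a set))"
    by (simp add: countable_finite finite_PiE)
  show "countable (carrier_vec (dim_row B) :: 'a vec set)"
    by (simp add: countable_finite finite_carrier_vec)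
qed (use splittings_finite_nonempty in \<open>auto simp: mult_mat_vec_def\<close>)

lemma index_map_mat_mult_vec:
  assumes "B \<in> carrier_mat r n" "x \<in> carrier_vec n" "i < r"
  shows "(map_mat \<iota> B *\<^sub>v x) $ i = (\<Sum>j<n. \<iota> (B $$ (i, j)) * x $ j)"
  using assms by (simp add: scalar_prod_def atLeast0LessThan)

section \<open>Security against k - |Z| observed combinations\<close>

text \<open>The \<open>card Z\<close> message coordinates and \<open>k - card Z\<close> independent
  forms on \<open>X\<close> are together \<open>k\<close> independent forms on codewords, so their
  joint value is uniform on a product. The observation \<open>B X\<close> is a function of the
  second factor alone.\<close>

lemma leakage_eq_0:
  assumes \<psi>: "scheme_pmf l \<psi> = pmf_of_set splittings" and Z: "Z \<subseteq> {..<l}"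
    and B: "B \<in> carrier_mat (k - card Z) n"
  shows "leakage \<iota> l \<psi> Z B = 0"
proof -
  define r where "r = k - card Z"
  have [simp]: "finite Z" using Z finite_subset by blast
  have "card Z \<le> l" using card_mono[OF _ Z] by simp
  then have k: "card Z + r = k" using l_le_k by (simp add: r_def)
  obtain w T where w: "independent_rows {..<r} n w"
    and T: "\<And>i j. i < r \<Longrightarrow> j < n \<Longrightarrow> B $$ (i, j) = (\<Sum>t<r. T i t * w t j)"
    using independent_rows_covering[of r n "\<lambda>i j. B $$ (i, j)"] k k_le_n by auto
  \<comment> \<open>\<open>h\<close> is the block matrix with the unit rows of \<open>Z\<close> on the message part and \<open>w\<close> on the rest.\<close>
  define I where "I = Z \<union> {l..<l + r}"
  define h where "h i j = (if i < l then if i = j then 1 else 0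
      else if j < l then 0 else w (i - l) (j - l))" for i j
  have disj: "Z \<inter> {l..<l + r} = {}" using Z by auto
  have "finite I" "card I = k"
    using k disj by (simp_all add: I_def card_Un_disjoint)
  have "independent_rows I (l + n) h"
    unfolding independent_rows_def
  proof (intro allI impI)
    fix c assume c: "\<forall>j<l + n. (\<Sum>i\<in>I. c i * h i j) = 0"
    have split: "(\<Sum>i\<in>I. c i * h i j) = (\<Sum>i\<in>Z. c i * h i j) + (\<Sum>t<r. c (l + t) * h (l + t) j)" for j
    proof -
      have "(\<Sum>i\<in>{l..<l + r}. c i * h i j) = (\<Sum>t<r. c (l + t) * h (l + t) j)"
        by (rule sum.reindex_bij_witness[of _ "\<lambda>t. l + t" "\<lambda>i. i - l"]) auto
      then show ?thesis
        using disj by (simp add: I_def sum.union_disjoint)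
    qed
    \<comment> \<open>Column \<open>z < l\<close> meets only the unit row of \<open>z\<close>, since
      the rows built from \<open>w\<close> vanish on the message part.\<close>
    have "c z = 0" if "z \<in> Z" for z
    proof -
      have "z < l" using that Z by auto
      have "(\<Sum>i\<in>Z. c i * h i z) = (\<Sum>i\<in>Z. if i = z then c i else 0)"
        using Z by (intro sum.cong) (auto simp: h_def)
      then show ?thesis
        using c[rule_format, of z] split[of z] that \<open>z < l\<close> by (simp add: h_def)
    qed
    \<comment> \<open>On the columns from \<open>l\<close> on the unit rows vanish, which leaves a
      relation among the rows of \<open>w\<close>.\<close>
    moreover have "c (l + t) = 0" if "t < r" for t
    proof -
      have "\<forall>j<n. (\<Sum>t<r. c (l + t) * w t j) = 0"
      proof (intro allI impI)
        fix j assume "j < n"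
        have "(\<Sum>i\<in>Z. c i * h i (l + j)) = 0"
          using Z by (intro sum.neutral) (auto simp: h_def)
        then show "(\<Sum>t<r. c (l + t) * w t j) = 0"
          using c[rule_format, of "l + j"] split[of "l + j"] \<open>j < n\<close> by (simp add: h_def)
      qed
      then show ?thesis
        using w[unfolded independent_rows_def, rule_format, of "\<lambda>t. c (l + t)" t] that by simp
    qed
    ultimately show "\<forall>i\<in>I. c i = 0"
      by (auto simp: I_def dest!: le_Suc_ex)
  qed
  define f where "f = (\<lambda>(s :: 'a vec, x :: 'a vec). restrict (\<lambda>i. s $ i) Z)"
  define g where "g = (\<lambda>(s :: 'a vec, x). restrict (\<lambda>t. \<Sum>j<n. \<iota> (w t j) * x $ j) {..<r})"
  \<comment> \<open>The coefficient matrix \<open>T\<close> acting over the large field: it recovers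
    \<open>B x\<close> from the values \<open>g (s, x)\<close> of the independent forms.\<close>
  define \<tau> where "\<tau> u = vec r (\<lambda>i. \<Sum>t<r. \<iota> (T i t) * u t)" for u
  let ?A = "Z \<rightarrow>\<^sub>E (UNIV :: 'a set)" and ?C = "{..<r} \<rightarrow>\<^sub>E (UNIV :: 'a set)"
  have inj: "inj_on (\<lambda>e. (f e, g e)) splittings"
  proof (rule inj_onI, clarify)
    fix s x s' x' assume e: "(s, x) \<in> splittings" "(s', x') \<in> splittings"
      and eq: "f (s, x) = f (s', x')" "g (s, x) = g (s', x')"
    show "s = s' \<and> x = x'"
    proof (rule separating_splittings[OF \<open>finite I\<close> \<open>card I = k\<close> \<open>independent_rows I (l + n) h\<close> e])
      fix i assume "i \<in> I"
      then consider "i \<in> Z" | t where "i = l + t" "t < r"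
        by (auto simp: I_def dest: le_Suc_ex)
      then show "(\<Sum>j<l. \<iota> (h i j) * s $ j) + (\<Sum>j<n. \<iota> (h i (l + j)) * x $ j) =
          (\<Sum>j<l. \<iota> (h i j) * s' $ j) + (\<Sum>j<n. \<iota> (h i (l + j)) * x' $ j)"
      proof cases
        case 1
        have "i < l" using 1 Z by auto
        have "(\<Sum>j<l. \<iota> (h i j) * v $ j) = (\<Sum>j<l. if j = i then v $ j else 0)" for v :: "'a vec"
          using \<open>i < l\<close> by (intro sum.cong) (auto simp: h_def)
        moreover have "s $ i = s' $ i"
          using fun_cong[OF eq(1), of i] 1 by (simp add: f_def)
        ultimately show ?thesis
          using \<open>i < l\<close> by (simp add: h_def)
      next
        case 2
        then show ?thesis
          using fun_cong[OF eq(2), of t] by (simp add: g_def h_def)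
      qed
    qed
  qed
  have "(\<lambda>e. (f e, g e)) ` splittings \<subseteq> ?A \<times> ?C"
    by (auto simp: f_def g_def split: if_splits)
  \<comment> \<open>As \<open>card Z + r = k\<close>, the target has exactly as many elements as the
    code, so the injection is onto and transports the uniform law.\<close>
  moreover have "card (?A \<times> ?C) = card splittings"
    using k by (simp add: card_splittings card_cartesian_product card_PiE flip: power_add)
  moreover have "finite (?A \<times> ?C)"
    by (simp add: finite_PiE)
  ultimately have "bij_betw (\<lambda>e. (f e, g e)) splittings (?A \<times> ?C)"
    using inj by (simp add: bij_betw_def card_subset_eq card_image)
  then have "map_pmf (\<lambda>e. (f e, g e)) (pmf_of_set splittings) = pmf_of_set (?A \<times> ?C)"
    using splittings_finite_nonempty by (intro map_pmf_of_set_bij_betw)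
  then have fg: "map_pmf (\<lambda>e. (f e, g e)) (pmf_of_set splittings)
      = pair_pmf (pmf_of_set ?A) (pmf_of_set ?C)"
    by (subst pair_pmf_of_set) (auto intro: finite_PiE simp: PiE_eq_empty_iff)
  define Y where "Y = (\<lambda>(s :: 'a vec, x). map_mat \<iota> B *\<^sub>v x)"
  have Y: "Y e = \<tau> (g e)" if "e \<in> splittings" for e
  proof -
    obtain s x where e: "e = (s, x)" "x \<in> carrier_vec n"
      using \<open>e \<in> splittings\<close> by (auto simp: splittings_def)
    show ?thesis
    proof (rule eq_vecI)
      fix i assume "i < dim_vec (\<tau> (g e))"
      then have i: "i < r" by (simp add: \<tau>_def)
      have "Y e $ i = (\<Sum>j<n. \<iota> (\<Sum>t<r. T i t * w t j) * x $ j)"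
        using index_map_mat_mult_vec[OF B e(2)] i T[OF i] by (simp add: Y_def e r_def)
      also have "\<dots> = (\<Sum>j<n. \<Sum>t<r. \<iota> (T i t) * (\<iota> (w t j) * x $ j))"
        by (simp add: hom_distribs sum_distrib_right mult.assoc)
      also have "\<dots> = (\<Sum>t<r. \<iota> (T i t) * (\<Sum>j<n. \<iota> (w t j) * x $ j))"
        by (subst sum.swap) (simp add: sum_distrib_left)
      finally show "Y e $ i = \<tau> (g e) $ i"
        using i by (simp add: \<tau>_def g_def e)
    qed (use B in \<open>simp add: Y_def \<tau>_def e r_def\<close>)
  qed
  \<comment> \<open>Applying \<open>\<tau>\<close> to the second factor keeps the law a product; its
    marginals are then read off by projection.\<close>
  have "map_pmf (\<lambda>e. (f e, Y e)) (pmf_of_set splittings)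
      = map_pmf (apsnd \<tau>) (map_pmf (\<lambda>e. (f e, g e)) (pmf_of_set splittings))"
    unfolding map_pmf_comp
    using splittings_finite_nonempty Y by (intro map_pmf_cong) auto
  also have "\<dots> = pair_pmf (pmf_of_set ?A) (map_pmf \<tau> (pmf_of_set ?C))"
    unfolding fg pair_map_pmf2 ..
  finally have fY: "map_pmf (\<lambda>e. (f e, Y e)) (pmf_of_set splittings)
      = pair_pmf (pmf_of_set ?A) (map_pmf \<tau> (pmf_of_set ?C))" .
  have "map_pmf f (pmf_of_set splittings) = pmf_of_set ?A"
    using arg_cong[OF fY, of "map_pmf fst"] by (simp add: map_pmf_comp map_fst_pair_pmf)
  moreover have "map_pmf Y (pmf_of_set splittings) = map_pmf \<tau> (pmf_of_set ?C)"
    using arg_cong[OF fY, of "map_pmf snd"] by (simp add: map_pmf_comp map_snd_pair_pmf)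
  ultimately show ?thesis
    using fY unfolding leakage_eq_0_iff[OF \<psi> Z] f_def Y_def by simp
qed

section \<open>Maximality: k observations reveal the codeword\<close>

text \<open>Reading the first \<open>k\<close> coordinates of \<open>X\<close> determines the whole
  codeword, so the observation cannot be independent of a message symbol that takes more than one
  value.\<close>

lemma leakage_neq_0:
  assumes \<psi>: "scheme_pmf l \<psi> = pmf_of_set splittings" and "k \<le> r"
  shows "\<exists>B\<in>carrier_mat r n. leakage \<iota> l \<psi> {0} B \<noteq> 0"
proof
  \<comment> \<open>Row \<open>i\<close> reads coordinate \<open>i\<close> of \<open>X\<close>, and
    is zero for \<open>i \<ge> n\<close>, which covers \<open>r > n\<close>. Both
    \<open>k \<le> r\<close> and \<open>k \<le> n\<close> hold, so the first \<open>k\<close>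
    coordinates are always seen.\<close>
  define B :: "'q mat" where "B = mat r n (\<lambda>(i, j). if i = j then 1 else 0)"
  show "B \<in> carrier_mat r n" by (simp add: B_def)
  define f where "f = (\<lambda>(s :: 'a vec, x :: 'a vec). restrict (\<lambda>i. s $ i) {0})"
  define Y where "Y = (\<lambda>(s :: 'a vec, x). map_mat \<iota> B *\<^sub>v x)"
  have inj: "e = e'" if "e \<in> splittings" "e' \<in> splittings" "Y e = Y e'" for e e'
  proof -
    obtain s x s' x' where e: "e = (s, x)" "e' = (s', x')" "x \<in> carrier_vec n" "x' \<in> carrier_vec n"
      using \<open>e \<in> splittings\<close> \<open>e' \<in> splittings\<close> by (auto simp: splittings_def)
    \<comment> \<open>The form reading position \<open>l + i\<close> of the concatenated word, which
      is coordinate \<open>i\<close> of the transmitted part.\<close>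
    define h :: "nat \<Rightarrow> nat \<Rightarrow> 'q" where "h i j = (if j = l + i then 1 else 0)" for i j
    have "s = s' \<and> x = x'"
    proof (rule separating_splittings[of "{..<k}" h])
      show "independent_rows {..<k} (l + n) h"
        unfolding independent_rows_def
      proof (intro allI impI ballI)
        fix c i assume c: "\<forall>j<l + n. (\<Sum>i<k. c i * h i j) = 0" and "i \<in> {..<k}"
        have "(\<Sum>i'<k. c i' * h i' (l + i)) = (\<Sum>i'<k. if i' = i then c i' else 0)"
          by (intro sum.cong) (auto simp: h_def)
        also have "\<dots> = c i"
          using \<open>i \<in> {..<k}\<close> by simp
        finally show "c i = 0"
          using c[rule_format, of "l + i"] \<open>i \<in> {..<k}\<close> k_le_n by simp
      qed
      fix i assume "i \<in> {..<k}"
      then have i: "i < r" "i < n" using assms(2) k_le_n by auto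
      have coord: "(\<Sum>j<n. \<iota> (if i = j then 1 else 0) * v $ j) = v $ i" for v :: "'a vec"
      proof -
        have "(\<Sum>j<n. \<iota> (if i = j then 1 else 0) * v $ j) = (\<Sum>j<n. if j = i then v $ j else 0)"
          by (intro sum.cong) auto
        then show ?thesis using i by simp
      qed
      have "(map_mat \<iota> B *\<^sub>v v) $ i = v $ i" if "v \<in> carrier_vec n" for v
        using index_map_mat_mult_vec[OF \<open>B \<in> carrier_mat r n\<close> that i(1)] i
        by (simp add: B_def coord)
      then have "x $ i = x' $ i"
        using that(3) e by (metis Y_def case_prod_conv)
      then show "(\<Sum>j<l. \<iota> (h i j) * s $ j) + (\<Sum>j<n. \<iota> (h i (l + j)) * x $ j) =
          (\<Sum>j<l. \<iota> (h i j) * s' $ j) + (\<Sum>j<n. \<iota> (h i (l + j)) * x' $ j)"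
        using coord[of x] coord[of x'] by (simp add: h_def eq_commute[of _ i])
    qed (use that e in auto)
    then show ?thesis using e by simp
  qed
  show "leakage \<iota> l \<psi> {0} B \<noteq> 0"
  proof
    assume "leakage \<iota> l \<psi> {0} B = 0"
    then have prod: "map_pmf (\<lambda>e. (f e, Y e)) (pmf_of_set splittings)
      = pair_pmf (map_pmf f (pmf_of_set splittings)) (map_pmf Y (pmf_of_set splittings))"
      using leakage_eq_0_iff[OF \<psi>, of "{0}" B] l_pos unfolding f_def Y_def by auto
    have "\<exists>e\<in>splittings. f e 0 = a" for a
    proof -
      obtain x where "x \<in> carrier_vec n" "vec l (\<lambda>_. a) @\<^sub>v x \<in> D"
        using systematic[of "vec l (\<lambda>_. a)"] by auto
      then show ?thesis
        using l_pos by (intro bexI[of _ "(vec l (\<lambda>_. a), x)"]) (auto simp: splittings_def f_def)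
    qed
    then obtain e e' where e: "e \<in> splittings" "e' \<in> splittings" "f e 0 = 0" "f e' 0 = 1"
      by metis
    \<comment> \<open>Under independence the first symbol of \<open>e\<close> can occur with the
      observation of \<open>e'\<close>. The observation forces the codeword to be \<open>e'\<close>,
      whose first symbol is 1 and not 0.\<close>
    have "(f e, Y e') \<in> set_pmf (map_pmf (\<lambda>e. (f e, Y e)) (pmf_of_set splittings))"
      unfolding prod using splittings_finite_nonempty e by simp
    then have "(f e, Y e') \<in> (\<lambda>e. (f e, Y e)) ` splittings"
      using splittings_finite_nonempty by simp
    then obtain d where "d \<in> splittings" and d: "(f e, Y e') = (f d, Y d)"
      by blast
    then have "d = e'"
      using inj e by simp
    with d have "f e' = f e" by simp
    with e show False by simp
  qed
qed

lemma is_universal_max_strength: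
  assumes \<psi>: "scheme_pmf l \<psi> = pmf_of_set splittings"
  shows "is_universal_max_strength \<iota> l n \<psi> (int k - 1)"
  unfolding is_universal_max_strength_def
proof (intro conjI allI impI)
  show "universally_secure \<iota> l n \<psi> (int k - 1)"
    unfolding universally_secure_def
  proof (intro allI impI ballI)
    fix Z :: "nat set" and B :: "'q mat"
    assume Z: "Z \<subseteq> {..<l}" and B: "B \<in> carrier_mat (nat (int k - 1 - int (card Z) + 1)) n"
    have "nat (int k - 1 - int (card Z) + 1) = k - card Z" by linarith
    with B show "leakage \<iota> l \<psi> Z B = 0"
      by (intro leakage_eq_0[OF \<psi> Z]) simp
  qed
next
  fix \<omega> assume sec: "universally_secure \<iota> l n \<psi> \<omega>"
  show "\<omega> \<le> int k - 1"
  proof (rule ccontr)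
    assume "\<not> \<omega> \<le> int k - 1"
    \<comment> \<open>For \<open>Z = {0}\<close> the cardinality 1 cancels the \<open>+ 1\<close> in
      the row count, so exactly \<open>\<omega> \<ge> k\<close> rows are allowed; positivity makes
      the security condition nonvacuous.\<close>
    then have \<omega>: "k \<le> nat \<omega>" "\<omega> > 0" using l_pos l_le_k by linarith+
    obtain B where "B \<in> carrier_mat (nat \<omega>) n" "leakage \<iota> l \<psi> {0} B \<noteq> 0"
      using leakage_neq_0[OF \<psi> \<omega>(1)] by blast
    moreover have "{0} \<subseteq> {..<l}" using l_pos by auto
    ultimately show False
      using sec[unfolded universally_secure_def, rule_format, of "{0}" B] \<omega>(2) by simp
  qed
qed

end

section \<open>The coset coding scheme as a uniformly chosen codeword\<close>

text \<open>Codewords with the same message part differ by a codeword with zero message part, so the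
  coset of \<open>s\<close> is the fibre of the code over \<open>s\<close>. The codeword in
  \<open>sM\<close> supplies one point of that fibre.\<close>

lemma coset_encoder_eq:
  fixes D :: "'a::ring_1 vec set"
  assumes D: "D \<subseteq> carrier_vec (l + n)" "\<And>x y. x \<in> D \<Longrightarrow> y \<in> D \<Longrightarrow> x - y \<in> D"
    and M: "M \<in> carrier_mat l n" and s: "s \<in> carrier_vec l"
    and sM: "s @\<^sub>v (M\<^sup>T *\<^sub>v s) \<in> D"
  shows "coset_encoder M (shortened_code l n D) s = {x \<in> carrier_vec n. s @\<^sub>v x \<in> D}"
proof -
  let ?u = "M\<^sup>T *\<^sub>v s"
  have u: "?u \<in> carrier_vec n" using M s by simp
  \<comment> \<open>Closure under differences yields zero, then negatives and sums.\<close>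
  have zero: "0\<^sub>v (l + n) \<in> D"
    using D(2)[OF sM sM] D(1) sM by (metis minus_cancel_vec subsetD)
  have add: "x + y \<in> D" if "x \<in> D" "y \<in> D" for x y
  proof -
    have "x - (0\<^sub>v (l + n) - y) = x + y"
      using subsetD[OF D(1) \<open>x \<in> D\<close>] subsetD[OF D(1) \<open>y \<in> D\<close>] by (intro eq_vecI) auto
    with D(2)[OF \<open>x \<in> D\<close> D(2)[OF zero \<open>y \<in> D\<close>]] show ?thesis by simp
  qed
  show ?thesis
  proof (intro equalityI subsetI)
    fix x assume "x \<in> coset_encoder M (shortened_code l n D) s"
    then obtain z where z: "z \<in> D" "vec_first z l = 0\<^sub>v l" "x = ?u + vec_last z n"
      by (auto simp: coset_encoder_def shortened_code_def)
    have "0\<^sub>v l @\<^sub>v vec_last z n = z"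
      using vec_first_last_append[of z l n] z(1,2) D(1) by auto
    moreover have "(s @\<^sub>v ?u) + (0\<^sub>v l @\<^sub>v vec_last z n) = s @\<^sub>v x"
      using s u z(3) by (simp add: append_vec_add)
    ultimately have "s @\<^sub>v x = (s @\<^sub>v ?u) + z" by simp
    then show "x \<in> {x \<in> carrier_vec n. s @\<^sub>v x \<in> D}"
      using add[OF sM z(1)] z(3) u by simp
  next
    fix x assume "x \<in> {x \<in> carrier_vec n. s @\<^sub>v x \<in> D}"
    then have x: "x \<in> carrier_vec n" "s @\<^sub>v x \<in> D" by auto
    let ?z = "(s @\<^sub>v x) - (s @\<^sub>v ?u)"
    have "?z \<in> D" using D(2) x sM by blast
    moreover have "vec_first ?z l = 0\<^sub>v l"
      using s u x by (intro eq_vecI) (auto simp: vec_first_def)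
    moreover have "x = ?u + vec_last ?z n"
      using s u x M by (intro eq_vecI) (auto simp: vec_last_def)
    ultimately show "x \<in> coset_encoder M (shortened_code l n D) s"
      by (auto simp: coset_encoder_def shortened_code_def)
  qed
qed

theorem proposition49:
  fixes \<iota> :: "'q::{finite, field} \<Rightarrow> 'a::{finite, field}"
    and l n k m :: nat
    and D C\<^sub>1 C\<^sub>2 :: "'a vec set"
    and G P \<Delta>G G\<^sub>2 :: "'a mat"
    and \<psi> :: "'a vec \<Rightarrow> 'a vec set"
  assumes "field_hom \<iota>" and "ext_degree \<iota> = m"
    and "l \<ge> 1" and "n \<ge> 1" and "l \<le> k" and "k \<le> n" and "m \<ge> l + n"
    and "MRD_code \<iota> (l + n) D" and "code_dim (l + n) D = k"
    and "generator_matrix (l + n) D G"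
    and "P \<in> carrier_mat k (l + n - k)" and "G = append_cols (1\<^sub>m k) P"
    and "\<Delta>G \<in> carrier_mat l n" and "G\<^sub>2 \<in> carrier_mat (k - l) n"
    and "G = four_block_mat (1\<^sub>m l) \<Delta>G (0\<^sub>m (k - l) l) G\<^sub>2"
    and "C\<^sub>1 = punctured_code n D"
    and "C\<^sub>2 = shortened_code l n D"
    and "\<psi> = coset_encoder \<Delta>G C\<^sub>2"
  shows "is_universal_max_strength \<iota> l n \<psi> (int k - 1)"
proof -
  interpret V: vec_space "TYPE('a)" "l + n" .
  have G: "G \<in> carrier_mat k (l + n)"
    using \<open>generator_matrix (l + n) D G\<close> \<open>code_dim (l + n) D = k\<close> by (simp add: generator_matrix_def)
  have GT: "G\<^sup>T *\<^sub>v y \<in> carrier_vec (l + n)" for y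
    using G by (intro carrier_vecI) simp
  have "D = V.row_space G"
    using \<open>generator_matrix (l + n) D G\<close> by (simp add: generator_matrix_def)
  then have D: "D = (\<lambda>y. G\<^sup>T *\<^sub>v y) ` carrier_vec k"
    unfolding V.row_space_eq[OF G] using G GT by auto
  have D_carrier: "D \<subseteq> carrier_vec (l + n)"
    using D GT by auto
  have D_minus: "x - y \<in> D" if xy: "x \<in> D" "y \<in> D" for x y
  proof -
    obtain a b where "a \<in> carrier_vec k" "b \<in> carrier_vec k" "x = G\<^sup>T *\<^sub>v a" "y = G\<^sup>T *\<^sub>v b"
      using xy D by auto
    moreover from this have "x - y = G\<^sup>T *\<^sub>v (a - b)"
      using G by (simp add: mult_minus_distrib_mat_vec[of _ "l + n" k])
    ultimately show ?thesis using D by auto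
  qed
  \<comment> \<open>The identity block of the systematic generator matrix copies \<open>y\<close>
    into the first \<open>k\<close> positions, so encoding is injective and the code has
    \<open>CARD('a) ^ k\<close> elements.\<close>
  have GT_index: "(G\<^sup>T *\<^sub>v y) $ i = y $ i" if "y \<in> carrier_vec k" "i < k" for y i
  proof -
    have "col G i = unit_vec k i"
      unfolding \<open>G = append_cols (1\<^sub>m k) P\<close> append_cols_def using that \<open>P \<in> _\<close>
      by (intro eq_vecI) auto
    then show ?thesis
      using G that \<open>k \<le> n\<close> by simp
  qed
  have "inj_on (\<lambda>y. G\<^sup>T *\<^sub>v y) (carrier_vec k)"
  proof (rule inj_onI)
    fix y y' assume y: "y \<in> carrier_vec k" "y' \<in> carrier_vec k" "G\<^sup>T *\<^sub>v y = G\<^sup>T *\<^sub>v y'"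
    then show "y = y'"
      using GT_index by (intro eq_vecI) (auto, metis carrier_vecD)
  qed
  then have card_D: "card D = CARD('a) ^ k"
    unfolding D by (simp add: card_image card_carrier_vec)
  \<comment> \<open>Encoding \<open>s\<close> padded with \<open>k - l\<close> zeros selects the top
    block row of \<open>G\<close>, which yields \<open>s\<close> followed by its image under
    \<open>\<Delta>G\<close>.\<close>
  have sM: "s @\<^sub>v (\<Delta>G\<^sup>T *\<^sub>v s) \<in> D" if s: "s \<in> carrier_vec l" for s
  proof -
    have "G\<^sup>T = four_block_mat (1\<^sub>m l) (0\<^sub>m l (k - l)) \<Delta>G\<^sup>T G\<^sub>2\<^sup>T"
      unfolding \<open>G = four_block_mat _ _ _ _\<close>
      using transpose_four_block_mat[OF one_carrier_mat \<open>\<Delta>G \<in> _\<close> zero_carrier_mat \<open>G\<^sub>2 \<in> _\<close>]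
      by simp
    moreover have "A *\<^sub>v 0\<^sub>v (k - l) = 0\<^sub>v r" if "A \<in> carrier_mat r (k - l)" for A :: "'a mat" and r
      using that by (intro eq_vecI) auto
    ultimately have "G\<^sup>T *\<^sub>v (s @\<^sub>v 0\<^sub>v (k - l)) = s @\<^sub>v (\<Delta>G\<^sup>T *\<^sub>v s)"
      using s \<open>\<Delta>G \<in> _\<close> \<open>G\<^sub>2 \<in> _\<close>
      by (subst \<open>G\<^sup>T = _\<close>, subst four_block_mat_mult_vec[of _ l l _ "k - l" _ n]) auto
    moreover have "s @\<^sub>v 0\<^sub>v (k - l) \<in> carrier_vec k"
      using append_carrier_vec[OF s zero_carrier_vec[of "k - l"]] \<open>l \<le> k\<close> by simp
    ultimately show ?thesis
      unfolding D by (metis imageI)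
  qed
  interpret separating_code \<iota> l n k D
  proof (rule separating_code.intro)
    fix I :: "nat set" and h x y
    assume *: "finite I" "card I = k" "independent_rows I (l + n) h" "x \<in> D" "y \<in> D"
      and eq: "\<And>i. i \<in> I \<Longrightarrow> (\<Sum>j<l + n. \<iota> (h i j) * x $ j) = (\<Sum>j<l + n. \<iota> (h i j) * y $ j)"
    show "x = y"
    proof (rule MRD_code_separating[of \<iota> "l + n" D I h x y])
      show "card I = code_dim (l + n) D" using * assms(9) by simp
    qed (use assms(1,2,3,7,8) D_carrier D_minus * eq in auto)
  next
    show "\<exists>x\<in>carrier_vec n. s @\<^sub>v x \<in> D" if "s \<in> carrier_vec l" for s
      using sM[OF that] assms(13) that by (intro bexI[of _ "\<Delta>G\<^sup>T *\<^sub>v s"]) auto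
  qed (use assms(1,3,5,6) D_carrier card_D in auto)
  have \<psi>: "\<psi> s = {x \<in> carrier_vec n. s @\<^sub>v x \<in> D}" if "s \<in> carrier_vec l" for s
    unfolding assms(17,18) using D_carrier D_minus assms(13) that sM[OF that]
    by (rule coset_encoder_eq)
  \<comment> \<open>Each coset is a translate of the shortened code; the common size makes the
    two-stage choice of \<open>(S, X)\<close> uniform on \<open>splittings\<close>.\<close>
  have card_\<psi>: "card (\<psi> s) = card C\<^sub>2" if "s \<in> carrier_vec l" for s
  proof -
    have "inj_on (\<lambda>c. \<Delta>G\<^sup>T *\<^sub>v s + c) C\<^sub>2"
    proof (rule inj_onI)
      fix c c' assume c: "c \<in> C\<^sub>2" "c' \<in> C\<^sub>2" and eq: "\<Delta>G\<^sup>T *\<^sub>v s + c = \<Delta>G\<^sup>T *\<^sub>v s + c'"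
      have dims: "dim_vec c = n" "dim_vec c' = n"
        using c unfolding assms(17) by (auto simp: shortened_code_def)
      show "c = c'"
      proof (rule eq_vecI)
        fix i assume "i < dim_vec c'"
        then show "c $ i = c' $ i"
          using arg_cong[OF eq, of "\<lambda>v. v $ i"] dims assms(13) by simp
      qed (simp add: dims)
    qed
    then show ?thesis
      by (simp add: assms(18) coset_encoder_def card_image)
  qed
  have fin_\<psi>: "finite (\<psi> s)" if "s \<in> carrier_vec l" for s
    unfolding \<psi>[OF that] by (rule finite_subset[OF _ finite_carrier_vec]) auto
  have "card C\<^sub>2 > 0"
  proof -
    have "\<psi> (0\<^sub>v l) \<noteq> {}"
      using systematic[of "0\<^sub>v l"] \<psi>[of "0\<^sub>v l"] by auto
    then show ?thesis
      using card_\<psi>[of "0\<^sub>v l"] fin_\<psi>[of "0\<^sub>v l"] by (metis card_gt_0_iff zero_carrier_vec)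
  qed
  then have "scheme_pmf l \<psi> = pmf_of_set (Sigma (carrier_vec l) \<psi>)"
    unfolding scheme_pmf_def
    by (intro pmf_of_set_Sigma[of _ _ "card C\<^sub>2"] finite_carrier_vec card_\<psi> fin_\<psi>)
      (auto dest: equals0D[where a = "0\<^sub>v l"])
  also have "Sigma (carrier_vec l) \<psi> = splittings"
    using \<psi> by (auto simp: splittings_def)
  finally show ?thesis
    by (rule is_universal_max_strength)
qed

end
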